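(* Every graph with treewidth $k$ admits a $(k+1)$-local queue layout.
   Context: Graphs are finite, simple and undirected. Given a linear ordering $\prec$ of the vertex set of a graph, two edges $uv$ and $xy$ nest if $u \prec x \prec y \prec v$ or $x \prec u \prec v \prec y$ (for the endpoints named suitably). A queue is a set of edges no two of which nest. A queue layout of $G$ consists of a linear ordering $\prec$ of $V(G)$ and a partition of $E(G)$ into queues; it is $\ell$-local if every vertex has incident edges in at most $\ell$ queues (the total number of queues being arbitrary). *)

theory Defs
  imports "HOL-Library.Disjoint_Sets"
begin

section \<open>Graphs and trees\<close>

definition simple_graph :: "'a set \<Rightarrow> 'a set set \<Rightarrow> bool" where
  "simple_graph V E \<longleftrightarrow> finite V \<and> (\<forall>e\<in>E. e \<subseteq> V \<and> card e = 2)"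

definition induced_edges :: "'a set set \<Rightarrow> 'a set \<Rightarrow> 'a set set" where
  "induced_edges E X = {e \<in> E. e \<subseteq> X}"

definition connected_graph :: "'a set \<Rightarrow> 'a set set \<Rightarrow> bool" where
  "connected_graph V E \<longleftrightarrow> V \<noteq> {} \<and> (\<forall>u\<in>V. \<forall>v\<in>V. (u, v) \<in> {(x, y). {x, y} \<in> E}\<^sup>*)"

text \<open>A cycle is given by the list of its vertices, without repeating the first one at the end.\<close>

definition is_cycle :: "'a set set \<Rightarrow> 'a list \<Rightarrow> bool" where
  "is_cycle E p \<longleftrightarrow> length p \<ge> 3 \<and> distinct p \<and>
     (\<forall>i<length p. {p ! i, p ! (Suc i mod length p)} \<in> E)"

definition tree_graph :: "'a set \<Rightarrow> 'a set set \<Rightarrow> bool" where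
  "tree_graph V E \<longleftrightarrow> simple_graph V E \<and> connected_graph V E \<and> (\<nexists>p. is_cycle E p)"

section \<open>Treewidth\<close>

definition tree_decomposition ::
  "'a set \<Rightarrow> 'a set set \<Rightarrow> 't set \<Rightarrow> 't set set \<Rightarrow> ('t \<Rightarrow> 'a set) \<Rightarrow> bool" where
  "tree_decomposition V E T F B \<longleftrightarrow>
     tree_graph T F \<and>
     (\<Union>t\<in>T. B t) = V \<and>
     (\<forall>e\<in>E. \<exists>t\<in>T. e \<subseteq> B t) \<and>
     (\<forall>v\<in>V. connected_graph {t \<in> T. v \<in> B t} (induced_edges F {t \<in> T. v \<in> B t}))"

text \<open>
  Subtraction is truncated, so the width is \<open>0\<close> instead of \<open>-1\<close> if all bags are empty; this
  only happens for the graph without vertices, which thereby gets treewidth \<open>0\<close>.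
\<close>

definition decomposition_width :: "'t set \<Rightarrow> ('t \<Rightarrow> 'a set) \<Rightarrow> nat" where
  "decomposition_width T B = Max ((\<lambda>t. card (B t)) ` T) - 1"

text \<open>
  Decomposition trees are finite, so taking their nodes to be natural numbers is no restriction.
\<close>

definition treewidth :: "'a set \<Rightarrow> 'a set set \<Rightarrow> nat" where
  "treewidth V E = (LEAST w. \<exists>(T :: nat set) F B.
     tree_decomposition V E T F B \<and> decomposition_width T B = w)"

lemma tree_decomposition_single_bag:
  assumes "simple_graph V E"
  shows "tree_decomposition V E {t} {} (\<lambda>_. V)"
proof -
  have "\<not> is_cycle {} p" for p :: "'b list"
    by (cases p) (auto simp: is_cycle_def)
  then show ?thesis
    using assms
    by (auto simp: tree_decomposition_def tree_graph_def simple_graph_def connected_graph_def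
        induced_edges_def)
qed

lemma treewidth_attained:
  assumes "simple_graph V E"
  obtains T :: "nat set" and F B
  where "tree_decomposition V E T F B" and "decomposition_width T B = treewidth V E"
proof -
  have "\<exists>w. \<exists>(T :: nat set) F B. tree_decomposition V E T F B \<and> decomposition_width T B = w"
    using tree_decomposition_single_bag[OF assms, of "0 :: nat"] by blast
  from LeastI_ex[OF this] show thesis
    using that unfolding treewidth_def by blast
qed

section \<open>Local queue layouts\<close>

text \<open>The relation \<open>r\<close> is a strict linear ordering, with \<open>(u, v) \<in> r\<close> for \<open>u \<prec> v\<close>.\<close>

definition nest :: "'a rel \<Rightarrow> 'a set \<Rightarrow> 'a set \<Rightarrow> bool" where
  "nest r e f \<longleftrightarrow> (\<exists>u v x y. e = {u, v} \<and> f = {x, y} \<and>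
     ((u, x) \<in> r \<and> (x, y) \<in> r \<and> (y, v) \<in> r \<or> (x, u) \<in> r \<and> (u, v) \<in> r \<and> (v, y) \<in> r))"

definition is_queue :: "'a rel \<Rightarrow> 'a set set \<Rightarrow> bool" where
  "is_queue r q \<longleftrightarrow> (\<forall>e\<in>q. \<forall>f\<in>q. e \<noteq> f \<longrightarrow> \<not> nest r e f)"

definition queue_layout :: "'a set \<Rightarrow> 'a set set \<Rightarrow> 'a rel \<Rightarrow> 'a set set set \<Rightarrow> bool" where
  "queue_layout V E r Q \<longleftrightarrow>
     strict_linear_order_on V r \<and> partition_on E Q \<and> (\<forall>q\<in>Q. is_queue r q)"

definition local_queue_layout ::
  "nat \<Rightarrow> 'a set \<Rightarrow> 'a set set \<Rightarrow> 'a rel \<Rightarrow> 'a set set set \<Rightarrow> bool" where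
  "local_queue_layout l V E r Q \<longleftrightarrow>
     queue_layout V E r Q \<and> (\<forall>v\<in>V. card {q \<in> Q. \<exists>e\<in>q. v \<in> e} \<le> l)"

end

theory Submission
  imports Defs
begin

text \<open>
  Two edges with a common endpoint never nest, so a star is a queue whatever the vertex ordering.
  Hence it is enough to orient the edges such that every vertex has at most \<open>k\<close> out-neighbours
  and to let every vertex own the queue of its incoming edges: a vertex meets its own queue and those
  of its out-neighbours. The orientation comes from removing the leaves of a decomposition tree one
  after the other. A vertex whose last bag disappears with the leaf \<open>l\<close> points to the other
  vertices of that bag; any other vertex of that bag also lies in the bag of the neighbour of
  \<open>l\<close>.
\<close>

section \<open>Leaves and their removal\<close>

text \<open>An end of a longest path in \<open>T\<close> is a leaf: by maximality all its neighbours
  in \<open>T\<close> lie on the path, and a second one would close a cycle. Leaf means at most one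
  neighbour in \<open>T\<close>, so isolated nodes count and edges of \<open>F\<close> may leave
  \<open>T\<close>.\<close>

lemma acyclic_graph_has_leaf:
  assumes fin: "finite T" and ne: "T \<noteq> {}"
    and two: "\<And>e. e \<in> F \<Longrightarrow> card e = 2"
    and acyc: "\<nexists>p. is_cycle F p"
  obtains l where "l \<in> T"
    and "\<And>x y. \<lbrakk>x \<in> T; y \<in> T; {l, x} \<in> F; {l, y} \<in> F\<rbrakk> \<Longrightarrow> x = y"
proof -
  define path where "path p \<longleftrightarrow> p \<noteq> [] \<and> distinct p \<and> set p \<subseteq> T \<and>
    successively (\<lambda>x y. {x, y} \<in> F) p" for p
  obtain t where "t \<in> T" using ne by blast
  then have "path [t]" by (simp add: path_def)
  moreover have "\<forall>p. path p \<longrightarrow> length p < Suc (card T)"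
    using fin by (metis path_def card_mono distinct_card less_Suc_eq_le)
  ultimately obtain p where p: "path p" and longest: "\<And>q. path q \<Longrightarrow> length q \<le> length p"
    using ex_has_greatest_nat[of path "[t]" length "Suc (card T)"] by blast
  have adj: "{p ! i, p ! Suc i} \<in> F" if "Suc i < length p" for i
    using p that by (auto simp: path_def successively_conv_nth)
  define l where "l = p ! 0"
  have l: "l = hd p" and pne: "p \<noteq> []" using p by (auto simp: path_def l_def hd_conv_nth)
  have index: "\<exists>i. 0 < i \<and> i < length p \<and> p ! i = x" if "x \<in> T" "{l, x} \<in> F" for x
  proof -
    have "x \<noteq> l" using two[OF that(2)] by auto
    have "x \<in> set p"
    proof (rule ccontr)
      assume "x \<notin> set p"
      then have "path (x # p)"
        using p that l pne by (auto simp: path_def successively_Cons insert_commute)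
      from longest[OF this] show False by simp
    qed
    then obtain i where "i < length p" "p ! i = x" by (auto simp: in_set_conv_nth)
    with \<open>x \<noteq> l\<close> show ?thesis by (intro exI[of _ i]) (auto simp: l_def intro: gr0I)
  qed
  \<comment> \<open>The edge from \<open>p ! j\<close> back to \<open>l\<close> closes the prefix
    ending at \<open>j\<close>; an index \<open>i\<close> strictly between \<open>0\<close> and
    \<open>j\<close> makes this prefix at least three vertices long.\<close>
  have no_chord: False if "0 < i" "i < j" "j < length p" "{l, p ! j} \<in> F" for i j
  proof -
    have "is_cycle F (take (Suc j) p)"
      unfolding is_cycle_def
    proof (intro conjI allI impI)
      show "3 \<le> length (take (Suc j) p)" using that by auto
      show "distinct (take (Suc j) p)" using p by (simp add: path_def)
      have len: "length (take (Suc j) p) = Suc j" using that by simp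
      fix m assume "m < length (take (Suc j) p)"
      then have "m = j \<or> m < j" using that by auto
      then show "{take (Suc j) p ! m, take (Suc j) p ! (Suc m mod length (take (Suc j) p))} \<in> F"
        unfolding len using that adj[of m] by (auto simp: l_def insert_commute)
    qed
    with acyc show False by blast
  qed
  show thesis
  proof (rule that)
    show "l \<in> T" using p by (auto simp: path_def l_def)
    fix x y assume *: "x \<in> T" "y \<in> T" "{l, x} \<in> F" "{l, y} \<in> F"
    obtain i j where "0 < i" "i < length p" "p ! i = x" "0 < j" "j < length p" "p ! j = y"
      using index[of x] index[of y] * by blast
    with no_chord[of i j] no_chord[of j i] * show "x = y" by (metis linorder_neqE_nat)
  qed
qed

text \<open>A walk that visits \<open>l\<close> enters and leaves it through the same neighbour, so
  the detour can be cut out.\<close>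

lemma connected_graph_remove_leaf:
  assumes conn: "connected_graph X (induced_edges F X)"
    and two: "\<And>e. e \<in> F \<Longrightarrow> card e = 2"
    and leaf: "\<And>x y. \<lbrakk>x \<in> X; y \<in> X; {l, x} \<in> F; {l, y} \<in> F\<rbrakk> \<Longrightarrow> x = y"
    and ne: "X - {l} \<noteq> {}"
  shows "connected_graph (X - {l}) (induced_edges F (X - {l}))"
proof -
  let ?R = "{(x, y). {x, y} \<in> induced_edges F X}"
  let ?S = "{(x, y). {x, y} \<in> induced_edges F (X - {l})}"
  \<comment> \<open>Invariant along a walk from \<open>u\<close>: while the walk sits at
    \<open>l\<close>, it records that every neighbour of \<open>l\<close> in \<open>X\<close> was
    already reached without \<open>l\<close>, so the step out of \<open>l\<close> costs
    nothing.\<close>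
  have *: "(w \<noteq> l \<longrightarrow> (u, w) \<in> ?S\<^sup>*) \<and> (w = l \<longrightarrow> (\<forall>x\<in>X. {l, x} \<in> F \<longrightarrow> (u, x) \<in> ?S\<^sup>*))"
    if "(u, w) \<in> ?R\<^sup>*" "u \<noteq> l" for u w
    using that
  proof (induction rule: rtrancl_induct)
    case base
    then show ?case by simp
  next
    case (step w w')
    have e: "{w, w'} \<in> F" "w \<in> X" "w' \<in> X" using step.hyps by (auto simp: induced_edges_def)
    have "w \<noteq> w'" using two[OF e(1)] by auto
    consider "w = l" "w' \<noteq> l" | "w \<noteq> l" "w' = l" | "w \<noteq> l" "w' \<noteq> l"
      using \<open>w \<noteq> w'\<close> by blast
    then show ?case
    proof cases
      case 1
      then show ?thesis using step.IH step.prems e by blast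
    next
      case 2
      then have "{l, w} \<in> F" using e by (simp add: insert_commute)
      then have "x = w" if "x \<in> X" "{l, x} \<in> F" for x using leaf that e by blast
      then show ?thesis using 2 step.IH step.prems by blast
    next
      case 3
      then have "(w, w') \<in> ?S" using e by (auto simp: induced_edges_def)
moreover have "(u, w) \<in> ?S\<^sup>*" using 3 step.IH step.prems by blast
      ultimately have "(u, w') \<in> ?S\<^sup>*" by (blast intro: rtrancl_into_rtrancl)
      with 3 show ?thesis by blast
    qed
  qed
  show ?thesis
    unfolding connected_graph_def
  proof (intro conjI ballI)
    show "X - {l} \<noteq> {}" by (rule ne)
    fix u w assume "u \<in> X - {l}" "w \<in> X - {l}"
    then show "(u, w) \<in> ?S\<^sup>*" using *[of u w] conn by (auto simp: connected_graph_def)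
  qed
qed

section \<open>Orientation by induction on the decomposition tree\<close>

text \<open>\<open>P v\<close> is the set of out-neighbours of \<open>v\<close>. All pairs in a
  common bag get oriented, not only edges of the graph. The hypotheses are those that survive
  deleting a node from \<open>T\<close> while \<open>F\<close> stays fixed.\<close>

lemma tree_decomposition_orientation:
  assumes "finite T"
    and two: "\<And>e. e \<in> F \<Longrightarrow> card e = 2"
    and acyc: "\<nexists>p. is_cycle F p"
    and "\<And>t. t \<in> T \<Longrightarrow> finite (B t) \<and> card (B t) \<le> k + 1"
    and "\<And>v. {t \<in> T. v \<in> B t} \<noteq> {} \<Longrightarrow>
      connected_graph {t \<in> T. v \<in> B t} (induced_edges F {t \<in> T. v \<in> B t})"
  shows "\<exists>P. (\<forall>v. finite (P v) \<and> card (P v) \<le> k) \<and>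
    (\<forall>t\<in>T. \<forall>u\<in>B t. \<forall>v\<in>B t. u \<noteq> v \<longrightarrow> u \<in> P v \<or> v \<in> P u)"
  using assms(1,4,5)
proof (induction T rule: finite_psubset_induct)
  case (psubset T)
  show ?case
  proof (cases "T = {}")
    case True
    then show ?thesis by (intro exI[of _ "\<lambda>_. {}"]) simp
  next
    case False
    obtain l where l: "l \<in> T"
      and leaf: "\<And>x y. \<lbrakk>x \<in> T; y \<in> T; {l, x} \<in> F; {l, y} \<in> F\<rbrakk> \<Longrightarrow> x = y"
      using acyclic_graph_has_leaf[OF psubset.hyps(1) False two acyc] by metis
    let ?T = "T - {l}"
    have eq: "{t \<in> ?T. v \<in> B t} = {t \<in> T. v \<in> B t} - {l}" for v by blast
    have "\<exists>P. (\<forall>v. finite (P v) \<and> card (P v) \<le> k) \<and>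
      (\<forall>t\<in>?T. \<forall>u\<in>B t. \<forall>v\<in>B t. u \<noteq> v \<longrightarrow> u \<in> P v \<or> v \<in> P u)"
    proof (rule psubset.IH)
      show "?T \<subset> T" using l by blast
      show "finite (B t) \<and> card (B t) \<le> k + 1" if "t \<in> ?T" for t using psubset.prems(1) that by blast
      show "connected_graph {t \<in> ?T. v \<in> B t} (induced_edges F {t \<in> ?T. v \<in> B t})"
        if "{t \<in> ?T. v \<in> B t} \<noteq> {}" for v
        unfolding eq
      proof (rule connected_graph_remove_leaf)
        show "connected_graph {t \<in> T. v \<in> B t} (induced_edges F {t \<in> T. v \<in> B t})"
          using that by (intro psubset.prems(2)) blast
        show "{t \<in> T. v \<in> B t} - {l} \<noteq> {}" using that by blast
      qed (use two leaf in auto)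
    qed
    then obtain P where P: "\<And>v. finite (P v)" "\<And>v. card (P v) \<le> k"
      and cover: "\<And>t u v. \<lbrakk>t \<in> ?T; u \<in> B t; v \<in> B t; u \<noteq> v\<rbrakk> \<Longrightarrow> u \<in> P v \<or> v \<in> P u"
      by metis
    define N where "N = B l - (\<Union>t\<in>?T. B t)"
    \<comment> \<open>Vertices of \<open>N\<close> occur in no remaining bag, so overwriting
      \<open>P\<close> there spoils no pair already covered. Leaving \<open>v\<close> out of its bag
      brings the bound \<open>k + 1\<close> down to \<open>k\<close>.\<close>
    define P' where "P' v = (if v \<in> N then B l - {v} else P v)" for v
    \<comment> \<open>Such a \<open>v\<close> lies in a second bag \<open>B s\<close>; the first
      edge of a walk from \<open>l\<close> to \<open>s\<close> through bags containing
      \<open>v\<close> ends in the required \<open>p\<close>.\<close>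
    have neighbour: "\<exists>p\<in>?T. {l, p} \<in> F \<and> v \<in> B p" if v: "v \<in> B l" "v \<notin> N" for v
    proof -
      obtain s where s: "s \<in> ?T" "v \<in> B s" using v unfolding N_def by blast
      then have "(l, s) \<in> {(x, y). {x, y} \<in> induced_edges F {t \<in> T. v \<in> B t}}\<^sup>*"
        using psubset.prems(2)[of v] l v by (auto simp: connected_graph_def)
      then obtain p where "{l, p} \<in> induced_edges F {t \<in> T. v \<in> B t}"
        using s by (auto elim: converse_rtranclE)
      then have p: "{l, p} \<in> F" "p \<in> T" "v \<in> B p" by (auto simp: induced_edges_def)
      moreover have "p \<noteq> l" using two[OF p(1)] by auto
      ultimately show ?thesis by blast
    qed
    have "finite (P' v) \<and> card (P' v) \<le> k" for v
      using P[of v] psubset.prems(1)[OF l] by (auto simp: P'_def N_def)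
    moreover have "u \<in> P' v \<or> v \<in> P' u" if t: "t \<in> T" and uv: "u \<in> B t" "v \<in> B t" "u \<noteq> v" for t u v
    proof (cases "t = l")
      case False
      then have "u \<notin> N" "v \<notin> N" using t uv by (auto simp: N_def)
      then show ?thesis using cover[of t u v] False t uv by (auto simp: P'_def)
    next
      case True
      show ?thesis
      proof (cases "u \<in> N \<or> v \<in> N")
        case True
        then show ?thesis using uv \<open>t = l\<close> by (auto simp: P'_def)
      next
        case False
        then obtain p q where pq: "p \<in> ?T" "{l, p} \<in> F" "u \<in> B p" "q \<in> ?T" "{l, q} \<in> F" "v \<in> B q"
          using neighbour[of u] neighbour[of v] uv \<open>t = l\<close> by blast
        \<comment> \<open>The leaf has only one neighbour in \<open>T\<close>, so \<open>u\<close>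
          and \<open>v\<close> share its bag and the induction hypothesis covers them.\<close>
        then have "p = q" using leaf by blast
        then show ?thesis using cover[of p u v] pq uv False by (auto simp: P'_def)
      qed
    qed
    ultimately show ?thesis by blast
  qed
qed

section \<open>From orientations to local queue layouts\<close>

lemma ex_strict_linear_order_on:
  assumes "finite V"
  shows "\<exists>r. strict_linear_order_on V r"
proof -
  obtain f :: "'a \<Rightarrow> nat" where "inj_on f V"
    using finite_imp_inj_to_nat_seg[OF assms] by blast
  then have "strict_linear_order_on V {(u, v). f u < f v}"
    by (auto simp: strict_linear_order_on_def trans_def irrefl_def total_on_def inj_on_def)
      (metis linorder_neqE_nat)
  then show ?thesis by blast
qed

text \<open>Nesting edges have endpoints in a strict chain of four, hence are disjoint, whereas
  edges of a star share \<open>c\<close>.\<close>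

lemma star_is_queue:
  assumes r: "strict_linear_order_on V r" and star: "\<And>e. e \<in> q \<Longrightarrow> c \<in> e"
  shows "is_queue r q"
proof -
  have irr: "(x, x) \<notin> r" for x
    using r by (auto simp: strict_linear_order_on_def irrefl_def)
  have tr: "(x, z) \<in> r" if "(x, y) \<in> r" "(y, z) \<in> r" for x y z
    using r that by (auto simp: strict_linear_order_on_def elim: transD)
  have disjnt: "{a, d} \<inter> {b, c} = {}" if "(a, b) \<in> r" "(b, c) \<in> r" "(c, d) \<in> r" for a b c d
    using irr that tr[OF that(1,2)] tr[OF that(2,3)] by auto
  have "e \<inter> f = {}" if "nest r e f" for e f
    using that unfolding nest_def by (metis disjnt inf_commute)
  then show ?thesis using star unfolding is_queue_def by blast
qed

lemma orientation_imp_local_queue_layout: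
  assumes graph: "simple_graph V E"
    and P: "\<And>v. finite (P v)" "\<And>v. card (P v) \<le> k"
    and cover: "\<And>u v. {u, v} \<in> E \<Longrightarrow> u \<in> P v \<or> v \<in> P u"
  shows "\<exists>r Q. local_queue_layout (k + 1) V E r Q"
proof -
  have "finite V" using graph by (simp add: simple_graph_def)
  then obtain r where r: "strict_linear_order_on V r" using ex_strict_linear_order_on by blast
  \<comment> \<open>Here \<open>c\<close> is the head of \<open>e\<close>; the function
    \<open>h\<close> chosen below fixes one head for each edge, even if both directions are
    available.\<close>
  have "\<exists>c. c \<in> e \<and> (\<forall>v\<in>e. v = c \<or> c \<in> P v)" if "e \<in> E" for e
  proof -
    have "card e = 2" using graph that by (simp add: simple_graph_def)
    then obtain u v where "e = {u, v}" by (auto simp: card_2_iff)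
    then show ?thesis using cover[of u v] that by auto
  qed
  then obtain h where h: "\<And>e. e \<in> E \<Longrightarrow> h e \<in> e"
    and hP: "\<And>e v. \<lbrakk>e \<in> E; v \<in> e\<rbrakk> \<Longrightarrow> v = h e \<or> h e \<in> P v"
    by metis
  define star where "star c = {e \<in> E. h e = c}" for c
  \<comment> \<open>Taking only the heads that occur keeps empty stars out, as
    \<open>partition_on\<close> demands.\<close>
  define Q where "Q = star ` h ` E"
  have "partition_on E Q"
    by (auto simp: partition_on_def Q_def star_def disjoint_def)
  moreover have "is_queue r q" if q: "q \<in> Q" for q
  proof -
    obtain c where "q = star c" using q by (auto simp: Q_def)
    then show ?thesis using h by (intro star_is_queue[OF r, of q c]) (auto simp: star_def)
  qed
  moreover have "card {q \<in> Q. \<exists>e\<in>q. v \<in> e} \<le> k + 1" for v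
  proof -
    \<comment> \<open>An edge at \<open>v\<close> has as its head either \<open>v\<close> or a
      member of \<open>P v\<close>; the former accounts for the \<open>+ 1\<close>.\<close>
    have "{q \<in> Q. \<exists>e\<in>q. v \<in> e} \<subseteq> star ` insert v (P v)"
      using hP by (fastforce simp: Q_def star_def)
    then have "card {q \<in> Q. \<exists>e\<in>q. v \<in> e} \<le> card (insert v (P v))"
      using P(1) by (meson card_image_le card_mono finite_imageI finite_insert le_trans)
    also have "\<dots> \<le> k + 1"
      using P[of v] by (simp add: card_insert_if)
    finally show ?thesis .
  qed
  ultimately have "local_queue_layout (k + 1) V E r Q"
    using r by (simp add: local_queue_layout_def queue_layout_def)
  then show ?thesis by blast
qed

theorem theorem3:
  fixes V :: "'a set" and E :: "'a set set" and k :: nat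
  assumes "simple_graph V E"
    and "treewidth V E = k"
  shows "\<exists>r Q. local_queue_layout (k + 1) V E r Q"
proof -
  obtain T :: "nat set" and F B
    where td: "tree_decomposition V E T F B" and width: "decomposition_width T B = k"
    using treewidth_attained[OF assms(1)] assms(2) by metis
  have T: "finite T" and two: "\<And>e. e \<in> F \<Longrightarrow> card e = 2" and acyc: "\<nexists>p. is_cycle F p"
    using td by (auto simp: tree_decomposition_def tree_graph_def simple_graph_def)
  have bags: "(\<Union>t\<in>T. B t) = V" and edges: "\<forall>e\<in>E. \<exists>t\<in>T. e \<subseteq> B t"
    and conn: "\<forall>v\<in>V. connected_graph {t \<in> T. v \<in> B t} (induced_edges F {t \<in> T. v \<in> B t})"
    using td by (auto simp: tree_decomposition_def)
  have card_bag: "finite (B t) \<and> card (B t) \<le> k + 1" if "t \<in> T" for t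
  proof
    have "finite V" using assms(1) by (simp add: simple_graph_def)
    then show "finite (B t)" by (rule rev_finite_subset) (use bags that in blast)
    have "card (B t) \<le> Max ((\<lambda>t. card (B t)) ` T)"
      using T that by (intro Max_ge) auto
    \<comment> \<open>Truncated subtraction is harmless: a maximum of \<open>0\<close> gives
      \<open>k = 0\<close> and still satisfies the bound.\<close>
    then show "card (B t) \<le> k + 1"
      using width by (simp add: decomposition_width_def)
  qed
  have "\<exists>P. (\<forall>v. finite (P v) \<and> card (P v) \<le> k) \<and>
    (\<forall>t\<in>T. \<forall>u\<in>B t. \<forall>v\<in>B t. u \<noteq> v \<longrightarrow> u \<in> P v \<or> v \<in> P u)"
    using T two acyc card_bag
  proof (rule tree_decomposition_orientation)
    show "connected_graph {t \<in> T. v \<in> B t} (induced_edges F {t \<in> T. v \<in> B t})"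
      if "{t \<in> T. v \<in> B t} \<noteq> {}" for v
      using conn bags that by blast
  qed
  then obtain P where P: "\<And>v. finite (P v)" "\<And>v. card (P v) \<le> k"
    and cover: "\<And>t u v. \<lbrakk>t \<in> T; u \<in> B t; v \<in> B t; u \<noteq> v\<rbrakk> \<Longrightarrow> u \<in> P v \<or> v \<in> P u"
    by metis
  show ?thesis
  proof (rule orientation_imp_local_queue_layout[OF assms(1) P])
    fix u v assume e: "{u, v} \<in> E"
    then have "card {u, v} = 2" using assms(1) by (simp add: simple_graph_def)
    then have "u \<noteq> v" by auto
    moreover obtain t where "t \<in> T" "u \<in> B t" "v \<in> B t" using edges e by blast
    ultimately show "u \<in> P v \<or> v \<in> P u" by (intro cover)
  qed
qed

end
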